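(* The Eisenstein--Picard modular group $\mathbf{PU}(3,1;\mathbb{Z}[\omega_3])$ (the group $\mathbf{U}(3,1;\mathbb{Z}[\omega_3])$ regarded as acting on complex hyperbolic space, i.e. modulo scalar matrices) is generated by the classes of the four matrices $N_1$ (a Heisenberg translation), $M_{U_1}$, $M_{U_2}$ (two Heisenberg rotations) and $R$ (an involution), where $$N_1=\begin{pmatrix}1&-1&0&\omega_3\\0&1&0&1\\0&0&1&0\\0&0&0&1\end{pmatrix},\quad M_{U_1}=\begin{pmatrix}1&0&0&0\\0&0&1&0\\0&1&0&0\\0&0&0&1\end{pmatrix},$$ $$M_{U_2}=\begin{pmatrix}1&0&0&0\\0&-\omega_3&0&0\\0&0&1&0\\0&0&0&1\end{pmatrix},\quad R=\begin{pmatrix}0&0&0&1\\0&-1&0&0\\0&0&-1&0\\1&0&0&0\end{pmatrix}.$$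
   Context: Let $\omega_3=(-1+i\sqrt3)/2$ and $\mathbb{Z}[\omega_3]=\{a+b\omega_3: a,b\in\mathbb{Z}\}$. Let $J=\begin{pmatrix}0&0&1\\0&I_2&0\\1&0&0\end{pmatrix}$ (a $4\times4$ matrix in block form, with blocks of sizes $1,2,1$). $\mathbf{U}(3,1)$ is the group of complex $4\times 4$ matrices $G$ with $G^*JG=J$, where $G^*$ is the conjugate transpose, and $\mathbf{U}(3,1;\mathbb{Z}[\omega_3])$ is the subgroup of those matrices whose entries all lie in $\mathbb{Z}[\omega_3]$. $\mathbf{PU}(3,1;\mathbb{Z}[\omega_3])$ denotes the quotient of $\mathbf{U}(3,1;\mathbb{Z}[\omega_3])$ by its subgroup of scalar matrices $\{\lambda I:\lambda\in\{\pm1,\pm\omega_3,\pm\omega_3^2\}\}$, i.e. its image in the group of holomorphic isometries of complex hyperbolic 3-space. The matrix $N_1$ is the Heisenberg translation $N_{(\tau,t)}=\begin{pmatrix}1&-\tau^*&(-\|\tau\|^2+it)/2\\0&I_2&\tau\\0&0&1\end{pmatrix}$ with $\tau=(1,0)^T$ and $t=\sqrt3$. For $U\in\mathbf{U}(2)$, $M_U$ is the block-diagonal matrix $\mathrm{diag}(1,U,1)$; here $U_1=\begin{pmatrix}0&1\\1&0\end{pmatrix}$ and $U_2=\begin{pmatrix}-\omega_3&0\\0&1\end{pmatrix}$. *)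

theory Defs
  imports "HOL-Analysis.Analysis" "HOL-Algebra.Generated_Groups"
begin

definition \<omega>\<^sub>3 :: complex where
  "\<omega>\<^sub>3 = (- 1 + \<i> * complex_of_real (sqrt 3)) / 2"

definition Eisenstein_ints :: "complex set" where
  "Eisenstein_ints = {of_int a + of_int b * \<omega>\<^sub>3 | a b. True}"

definition conj_transpose :: "complex^'n^'m \<Rightarrow> complex^'m^'n" where
  "conj_transpose A = (\<chi> i j. cnj (A $ j $ i))"

definition J_form :: "complex^4^4" where
  "J_form = vector [vector [0, 0, 0, 1],
                    vector [0, 1, 0, 0],
                    vector [0, 0, 1, 0],
                    vector [1, 0, 0, 0]]"

definition U31 :: "(complex^4^4) monoid" where
  "U31 = \<lparr>carrier = {G. conj_transpose G ** J_form ** G = J_form},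
          monoid.mult = (**), one = mat 1\<rparr>"

definition U31_Eisenstein :: "(complex^4^4) monoid" where
  "U31_Eisenstein = U31\<lparr>carrier := {G \<in> carrier U31. \<forall>i j. G $ i $ j \<in> Eisenstein_ints}\<rparr>"

definition Eisenstein_units :: "complex set" where
  "Eisenstein_units = {1, - 1, \<omega>\<^sub>3, - \<omega>\<^sub>3, \<omega>\<^sub>3\<^sup>2, - (\<omega>\<^sub>3\<^sup>2)}"

definition unit_scalars :: "(complex^4^4) set" where
  "unit_scalars = mat ` Eisenstein_units"

definition PU31_Eisenstein :: "(complex^4^4) set monoid" where
  "PU31_Eisenstein = U31_Eisenstein Mod unit_scalars"

definition PU_class :: "complex^4^4 \<Rightarrow> (complex^4^4) set" where
  "PU_class G = unit_scalars #>\<^bsub>U31_Eisenstein\<^esub> G"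

text \<open>The general Heisenberg translation and rotation; the lemmas after the four generators
  identify the explicit matrices as instances.\<close>

definition heis_translation :: "complex^2 \<Rightarrow> real \<Rightarrow> complex^4^4" where
  "heis_translation \<tau> t =
     vector [vector [1, - cnj (\<tau> $ 1), - cnj (\<tau> $ 2),
                     (- complex_of_real ((norm \<tau>)\<^sup>2) + \<i> * complex_of_real t) / 2],
             vector [0, 1, 0, \<tau> $ 1],
             vector [0, 0, 1, \<tau> $ 2],
             vector [0, 0, 0, 1]]"

definition heis_rotation :: "complex^2^2 \<Rightarrow> complex^4^4" where
  "heis_rotation U =
     vector [vector [1, 0, 0, 0],
             vector [0, U $ 1 $ 1, U $ 1 $ 2, 0],
             vector [0, U $ 2 $ 1, U $ 2 $ 2, 0],
             vector [0, 0, 0, 1]]"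

definition N\<^sub>1 :: "complex^4^4" where
  "N\<^sub>1 = vector [vector [1, - 1, 0, \<omega>\<^sub>3],
                 vector [0, 1, 0, 1],
                 vector [0, 0, 1, 0],
                 vector [0, 0, 0, 1]]"

definition M_U\<^sub>1 :: "complex^4^4" where
  "M_U\<^sub>1 = vector [vector [1, 0, 0, 0],
                   vector [0, 0, 1, 0],
                   vector [0, 1, 0, 0],
                   vector [0, 0, 0, 1]]"

definition M_U\<^sub>2 :: "complex^4^4" where
  "M_U\<^sub>2 = vector [vector [1, 0, 0, 0],
                   vector [0, - \<omega>\<^sub>3, 0, 0],
                   vector [0, 0, 1, 0],
                   vector [0, 0, 0, 1]]"

definition R_mat :: "complex^4^4" where
  "R_mat = vector [vector [0, 0, 0, 1],
                   vector [0, - 1, 0, 0],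
                   vector [0, 0, - 1, 0],
                   vector [1, 0, 0, 0]]"

lemma N1_eq_heis_translation: "N\<^sub>1 = heis_translation (vector [1, 0]) (sqrt 3)"
  by (simp add: N\<^sub>1_def heis_translation_def \<omega>\<^sub>3_def norm_vec_def L2_set_def sum_2)

lemma M_U1_eq_heis_rotation:
  "M_U\<^sub>1 = heis_rotation (vector [vector [0, 1], vector [1, 0]])"
  by (simp add: M_U\<^sub>1_def heis_rotation_def)

lemma M_U2_eq_heis_rotation:
  "M_U\<^sub>2 = heis_rotation (vector [vector [- \<omega>\<^sub>3, 0], vector [0, 1]])"
  by (simp add: M_U\<^sub>2_def heis_rotation_def)

lemma R_mat_involution: "R_mat ** R_mat = mat 1"
  by (simp add: R_mat_def matrix_matrix_mult_def mat_def vec_eq_iff forall_4 sum_4 vector_def)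

lemma omega3_sq: "\<omega>\<^sub>3\<^sup>2 = - 1 - \<omega>\<^sub>3"
  by (simp add: \<omega>\<^sub>3_def complex_eq_iff power2_eq_square field_simps)

lemma cnj_omega3: "cnj \<omega>\<^sub>3 = - 1 - \<omega>\<^sub>3"
  by (simp add: \<omega>\<^sub>3_def complex_eq_iff field_simps)

lemma Eisenstein_ints_of_int: "of_int a \<in> Eisenstein_ints"
  unfolding Eisenstein_ints_def by (rule CollectI, rule exI[of _ a], rule exI[of _ 0]) simp

lemma Eisenstein_ints_omega3: "\<omega>\<^sub>3 \<in> Eisenstein_ints"
  unfolding Eisenstein_ints_def by (rule CollectI, rule exI[of _ 0], rule exI[of _ 1]) simp

lemma Eisenstein_ints_add:
  assumes "x \<in> Eisenstein_ints" "y \<in> Eisenstein_ints"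
  shows "x + y \<in> Eisenstein_ints"
proof -
  obtain a b c d where "x = of_int a + of_int b * \<omega>\<^sub>3" "y = of_int c + of_int d * \<omega>\<^sub>3"
    using assms unfolding Eisenstein_ints_def by blast
  then have "x + y = of_int (a + c) + of_int (b + d) * \<omega>\<^sub>3"
    by (simp add: algebra_simps)
  then show ?thesis unfolding Eisenstein_ints_def by blast
qed

lemma Eisenstein_ints_mult:
  assumes "x \<in> Eisenstein_ints" "y \<in> Eisenstein_ints"
  shows "x * y \<in> Eisenstein_ints"
proof -
  obtain a b c d where xy: "x = of_int a + of_int b * \<omega>\<^sub>3" "y = of_int c + of_int d * \<omega>\<^sub>3"
    using assms unfolding Eisenstein_ints_def by blast
  have "x * y = of_int a * of_int c + (of_int a * of_int d + of_int b * of_int c) * \<omega>\<^sub>3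
      + of_int b * of_int d * \<omega>\<^sub>3\<^sup>2"
    unfolding xy by (simp add: algebra_simps power2_eq_square)
  also have "\<dots> = of_int (a * c - b * d) + of_int (a * d + b * c - b * d) * \<omega>\<^sub>3"
    unfolding omega3_sq by (simp add: algebra_simps)
  finally show ?thesis unfolding Eisenstein_ints_def by blast
qed

lemma Eisenstein_ints_uminus: "x \<in> Eisenstein_ints \<Longrightarrow> - x \<in> Eisenstein_ints"
  using Eisenstein_ints_mult[OF Eisenstein_ints_of_int[of "- 1"], of x] by simp

lemma Eisenstein_ints_cnj:
  assumes "x \<in> Eisenstein_ints"
  shows "cnj x \<in> Eisenstein_ints"
proof -
  obtain a b where "x = of_int a + of_int b * \<omega>\<^sub>3"
    using assms unfolding Eisenstein_ints_def by blast
  then have "cnj x = of_int (a - b) + of_int (- b) * \<omega>\<^sub>3"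
    by (simp add: cnj_omega3 algebra_simps)
  then show ?thesis unfolding Eisenstein_ints_def by blast
qed

lemma Eisenstein_ints_sum: "(\<And>i. i \<in> A \<Longrightarrow> f i \<in> Eisenstein_ints) \<Longrightarrow> sum f A \<in> Eisenstein_ints"
  using Eisenstein_ints_of_int[of 0]
  by (induction A rule: infinite_finite_induct) (auto intro: Eisenstein_ints_add)

lemma Eisenstein_ints_matrix_mult:
  assumes "\<forall>i j. A $ i $ j \<in> Eisenstein_ints" "\<forall>i j. B $ i $ j \<in> Eisenstein_ints"
  shows "\<forall>i j. ((A::complex^4^4) ** B) $ i $ j \<in> Eisenstein_ints"
  using assms
  by (auto simp: matrix_matrix_mult_def intro!: Eisenstein_ints_sum Eisenstein_ints_mult)

lemma conj_transpose_mult: "conj_transpose (A ** B) = conj_transpose B ** conj_transpose A"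
  by (simp add: conj_transpose_def matrix_matrix_mult_def vec_eq_iff mult.commute)

lemma J_form_sq: "J_form ** J_form = mat 1"
  by (simp add: J_form_def matrix_matrix_mult_def mat_def vec_eq_iff forall_4 sum_4 vector_def)

lemma J_form_Eisenstein: "J_form $ i $ j \<in> Eisenstein_ints"
  using exhaust_4[of i] exhaust_4[of j] Eisenstein_ints_of_int[of 0] Eisenstein_ints_of_int[of 1]
  by (auto simp: J_form_def vector_def)

lemma U31_sel [simp]:
  "G \<in> carrier U31 \<longleftrightarrow> conj_transpose G ** J_form ** G = J_form"
  "monoid.mult U31 = (**)" "one U31 = mat 1"
  by (simp_all add: U31_def)

lemma U31_Eisenstein_sel [simp]:
  "G \<in> carrier U31_Eisenstein \<longleftrightarrow>
     conj_transpose G ** J_form ** G = J_form \<and> (\<forall>i j. G $ i $ j \<in> Eisenstein_ints)"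
  "monoid.mult U31_Eisenstein = (**)" "one U31_Eisenstein = mat 1"
  by (simp_all add: U31_Eisenstein_def)

lemma U31_mult_closed:
  assumes "conj_transpose A ** J_form ** A = J_form" "conj_transpose B ** J_form ** B = J_form"
  shows "conj_transpose (A ** B) ** J_form ** (A ** B) = J_form"
proof -
  have "conj_transpose (A ** B) ** J_form ** (A ** B)
      = conj_transpose B ** (conj_transpose A ** J_form ** A) ** B"
    by (simp add: conj_transpose_mult matrix_mul_assoc)
  then show ?thesis using assms by simp
qed

lemma U31_left_inverse:
  assumes "conj_transpose A ** J_form ** A = J_form"
  shows "(J_form ** conj_transpose A ** J_form) ** A = mat 1"
proof -
  have "(J_form ** conj_transpose A ** J_form) ** A = J_form ** (conj_transpose A ** J_form ** A)"
    by (simp add: matrix_mul_assoc)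
  then show ?thesis using assms J_form_sq by simp
qed

lemma U31_inverse_closed:
  assumes "conj_transpose A ** J_form ** A = J_form"
  defines "B \<equiv> J_form ** conj_transpose A ** J_form"
  shows "conj_transpose B ** J_form ** B = J_form"
proof -
  have AB: "A ** B = mat 1"
    using U31_left_inverse[OF assms(1)] unfolding B_def by (simp add: matrix_left_right_inverse)
  have "conj_transpose B ** conj_transpose A = mat 1"
    using arg_cong[OF AB, of conj_transpose]
    by (simp add: conj_transpose_mult) (simp add: conj_transpose_def mat_def vec_eq_iff)
  then have "J_form = conj_transpose B ** conj_transpose A ** J_form ** (A ** B)"
    using AB by simp
  also have "\<dots> = conj_transpose B ** (conj_transpose A ** J_form ** A) ** B"
    by (simp add: matrix_mul_assoc)
  finally show ?thesis using assms(1) by simp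
qed

lemma conj_transpose_mat [simp]: "conj_transpose (mat c) = mat (cnj c)"
  by (simp add: conj_transpose_def mat_def vec_eq_iff)

lemma group_U31: "Group.group U31"
proof (rule groupI)
  fix A assume "A \<in> carrier U31"
  then show "\<exists>B\<in>carrier U31. B \<otimes>\<^bsub>U31\<^esub> A = \<one>\<^bsub>U31\<^esub>"
    using U31_left_inverse U31_inverse_closed
    by (intro bexI[of _ "J_form ** conj_transpose A ** J_form"]) auto
next
  fix A B assume "A \<in> carrier U31" "B \<in> carrier U31"
  then show "A \<otimes>\<^bsub>U31\<^esub> B \<in> carrier U31"
    using U31_mult_closed by simp
qed (simp_all add: matrix_mul_assoc)

lemma subgroup_U31_Eisenstein: "subgroup (carrier U31_Eisenstein) U31"
proof -
  interpret Group.group U31 by (rule group_U31)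
  show ?thesis
  proof (rule subgroupI)
    have "mat 1 \<in> carrier U31_Eisenstein"
      using Eisenstein_ints_of_int[of 0] Eisenstein_ints_of_int[of 1]
      by simp (simp add: mat_def)
    then show "carrier U31_Eisenstein \<noteq> {}" by blast
  next
    fix A assume A: "A \<in> carrier U31_Eisenstein"
    let ?B = "J_form ** conj_transpose A ** J_form"
    have "\<forall>i j. conj_transpose A $ i $ j \<in> Eisenstein_ints"
      using A by (simp add: conj_transpose_def Eisenstein_ints_cnj)
    then have "\<forall>i j. ?B $ i $ j \<in> Eisenstein_ints"
      by (intro Eisenstein_ints_matrix_mult) (auto simp: J_form_Eisenstein)
    moreover have "inv\<^bsub>U31\<^esub> A = ?B"
      using A U31_left_inverse U31_inverse_closed by (intro inv_equality) auto
    ultimately show "inv\<^bsub>U31\<^esub> A \<in> carrier U31_Eisenstein"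
      using A U31_inverse_closed by simp
  next
    fix A B assume "A \<in> carrier U31_Eisenstein" "B \<in> carrier U31_Eisenstein"
    then show "A \<otimes>\<^bsub>U31\<^esub> B \<in> carrier U31_Eisenstein"
      using U31_mult_closed[of A B] Eisenstein_ints_matrix_mult[of A B] by simp
  qed auto
qed

lemma group_U31_Eisenstein: "Group.group U31_Eisenstein"
proof -
  have "U31_Eisenstein = U31\<lparr>carrier := carrier U31_Eisenstein\<rparr>"
    by (simp add: U31_Eisenstein_def)
  then show ?thesis
    using subgroup.subgroup_is_group[OF subgroup_U31_Eisenstein group_U31] by metis
qed

lemma mat_mult_mat: "(mat a :: complex^4^4) ** mat b = mat (a * b)"
  by (simp add: matrix_matrix_mult_def mat_def vec_eq_iff forall_4 sum_4)

lemma mat_commute: "mat c ** A = A ** mat c" for A :: "complex^4^4"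
  by (simp add: matrix_matrix_mult_def mat_def vec_eq_iff forall_4 sum_4)

lemma omega3_mult_self: "\<omega>\<^sub>3 * \<omega>\<^sub>3 = - 1 - \<omega>\<^sub>3"
  using omega3_sq by (simp add: power2_eq_square)

lemma Eisenstein_units_subset: "c \<in> Eisenstein_units \<Longrightarrow> c \<in> Eisenstein_ints"
  using Eisenstein_ints_of_int[of 1] Eisenstein_ints_omega3
    Eisenstein_ints_mult[OF Eisenstein_ints_omega3 Eisenstein_ints_omega3]
  by (auto simp: Eisenstein_units_def power2_eq_square intro: Eisenstein_ints_uminus)

lemma Eisenstein_units_uminus: "c \<in> Eisenstein_units \<Longrightarrow> - c \<in> Eisenstein_units"
  unfolding Eisenstein_units_def by (elim insertE emptyE) simp_all

lemma Eisenstein_units_omega3_mult: "c \<in> Eisenstein_units \<Longrightarrow> \<omega>\<^sub>3 * c \<in> Eisenstein_units"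
  unfolding Eisenstein_units_def omega3_sq
  by (elim insertE emptyE; hypsubst; simp add: algebra_simps omega3_mult_self)

lemma Eisenstein_units_mult:
  assumes "a \<in> Eisenstein_units" "b \<in> Eisenstein_units"
  shows "a * b \<in> Eisenstein_units"
  using assms(1) Eisenstein_units_omega3_mult[OF assms(2)] assms(2)
    Eisenstein_units_omega3_mult[OF Eisenstein_units_omega3_mult[OF assms(2)]]
  by (subst (asm) Eisenstein_units_def, elim insertE emptyE)
    (simp_all add: power2_eq_square mult.assoc Eisenstein_units_uminus)

lemma Eisenstein_units_norm: "c \<in> Eisenstein_units \<Longrightarrow> cnj c * c = 1"
  unfolding Eisenstein_units_def omega3_sq
  by (elim insertE emptyE; hypsubst; simp add: algebra_simps omega3_mult_self cnj_omega3)

lemma Eisenstein_units_cnj: "c \<in> Eisenstein_units \<Longrightarrow> cnj c \<in> Eisenstein_units"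
  unfolding Eisenstein_units_def omega3_sq
  by (elim insertE emptyE; hypsubst; simp add: cnj_omega3)

lemma Eisenstein_units_inverse: "c \<in> Eisenstein_units \<Longrightarrow> \<exists>d\<in>Eisenstein_units. d * c = 1"
  using Eisenstein_units_norm Eisenstein_units_cnj by blast

lemma normal_unit_scalars: "unit_scalars \<lhd> U31_Eisenstein"
proof -
  interpret Group.group U31_Eisenstein by (rule group_U31_Eisenstein)
  let ?u = Eisenstein_units
  have sub: "unit_scalars \<subseteq> carrier U31_Eisenstein"
  proof
    fix A assume "A \<in> unit_scalars"
    then obtain c where c: "c \<in> ?u" "A = mat c" unfolding unit_scalars_def by blast
    have "mat (cnj c) ** J_form ** mat c = (mat (cnj c * c) :: complex^4^4) ** J_form"
      by (simp only: mat_commute[of "cnj c"] mat_commute[of "cnj c * c"] matrix_mul_assoc[symmetric]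
          mat_mult_mat)
    then have "mat (cnj c) ** J_form ** mat c = J_form" using Eisenstein_units_norm[OF c(1)] by simp
    then show "A \<in> carrier U31_Eisenstein"
      using Eisenstein_units_subset[OF c(1)] Eisenstein_ints_of_int[of 0] c(2) by simp (simp add: mat_def)
  qed
  have "subgroup unit_scalars U31_Eisenstein"
  proof (rule subgroupI[OF sub])
    show "unit_scalars \<noteq> {}" unfolding unit_scalars_def Eisenstein_units_def by simp
  next
    fix A assume A: "A \<in> unit_scalars"
    then obtain c where c: "c \<in> ?u" "A = mat c" unfolding unit_scalars_def by blast
    obtain d where d: "d \<in> ?u" "d * c = 1" using Eisenstein_units_inverse[OF c(1)] by blast
    have D: "mat d \<in> unit_scalars" unfolding unit_scalars_def using d(1) by blast
    have "inv\<^bsub>U31_Eisenstein\<^esub> A = mat d"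
    proof (rule inv_equality)
      show "mat d \<otimes>\<^bsub>U31_Eisenstein\<^esub> A = \<one>\<^bsub>U31_Eisenstein\<^esub>"
        by (simp only: c(2) d(2) U31_Eisenstein_sel mat_mult_mat)
    qed (use A D sub in blast)+
    then show "inv\<^bsub>U31_Eisenstein\<^esub> A \<in> unit_scalars" using D by simp
  next
    fix A B assume "A \<in> unit_scalars" "B \<in> unit_scalars"
    then obtain a b where "a \<in> ?u" "b \<in> ?u" "A = mat a" "B = mat b"
      unfolding unit_scalars_def by blast
    then show "A \<otimes>\<^bsub>U31_Eisenstein\<^esub> B \<in> unit_scalars"
      using Eisenstein_units_mult[of a b] unfolding unit_scalars_def
      by (simp only: U31_Eisenstein_sel mat_mult_mat) blast
  qed
  then show ?thesis
  proof (rule normalI)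
    show "\<forall>A\<in>carrier U31_Eisenstein.
        unit_scalars #>\<^bsub>U31_Eisenstein\<^esub> A = A <#\<^bsub>U31_Eisenstein\<^esub> unit_scalars"
      unfolding r_coset_def l_coset_def unit_scalars_def U31_Eisenstein_sel
      by (intro ballI) (simp only: UN_simps mat_commute)
  qed
qed

lemma generators_in_U31_Eisenstein: "{N\<^sub>1, M_U\<^sub>1, M_U\<^sub>2, R_mat} \<subseteq> carrier U31_Eisenstein"
proof -
  note z = Eisenstein_ints_of_int[of 0] Eisenstein_ints_of_int[of 1]
    Eisenstein_ints_of_int[of "- 1"] Eisenstein_ints_omega3
    Eisenstein_ints_uminus[OF Eisenstein_ints_omega3]
  show ?thesis
    using z
    by (simp add: N\<^sub>1_def M_U\<^sub>1_def M_U\<^sub>2_def R_mat_def J_form_def conj_transpose_def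
        matrix_matrix_mult_def vec_eq_iff forall_4 sum_4 vector_def cnj_omega3
        omega3_mult_self algebra_simps)
qed

lemma group_PU31_Eisenstein: "Group.group PU31_Eisenstein"
  unfolding PU31_Eisenstein_def by (rule normal.factorgroup_is_group[OF normal_unit_scalars])

end

theory Submission
  imports Defs
begin

text \<open>
  The proof is a Euclidean algorithm on the first column \<open>(a, b, b', c)\<close> of a matrix of
  \<open>U(3,1; \<int>[\<omega>\<^sub>3])\<close>, that is, on the image of the point at infinity of the boundary of complex
  hyperbolic space. Write \<open>\<Gamma>\<close> for the group that the four matrices generate.

  If \<open>c \<noteq> 0\<close>, the image of infinity is a finite point with Heisenberg coordinates
  \<open>\<zeta> = (b/c, b'/c)\<close> and \<open>a/c = (- |\<zeta>|\<^sup>2 + i u)/2\<close>. The group \<open>\<Gamma>\<close> contains every integral Heisenberg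
  translation (\<open>integral_heis_in_\<Gamma>\<close>). These move \<open>\<zeta>\<close> by any vector of \<open>\<int>[\<omega>\<^sub>3]\<^sup>2\<close>, and those that fix \<open>\<zeta>\<close>
  move \<open>u\<close> by any multiple of \<open>2 \<surd>3\<close>; so one can reach \<open>|\<zeta>|\<^sup>2 \<le> 7/8\<close> and \<open>|u| \<le> \<surd>3\<close>. Then
  \<open>|a/c|\<^sup>2 \<le> (7/16)\<^sup>2 + 3/4 < 1\<close>, and the involution \<open>R\<close>, which exchanges \<open>a\<close> and \<open>c\<close>, yields a
  matrix whose lower left entry is strictly smaller (\<open>horoball_reduction\<close>). Since \<open>|c|\<^sup>2\<close> is a
  natural number, this ends with \<open>c = 0\<close>.

  If \<open>c = 0\<close>, the matrix fixes infinity. After division by a unit it is the product of an integral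
  Heisenberg translation and a rotation by some \<open>U \<in> U(2; \<int>[\<omega>\<^sub>3])\<close>. The columns of \<open>U\<close> have length 1
  and entries whose squared moduli are natural numbers, so \<open>U\<close> is a monomial matrix of units, and
  \<open>M_U\<^sub>1\<close>, \<open>M_U\<^sub>2\<close> generate all of these (\<open>unitary_rot_in_\<Gamma>\<close>, \<open>stabilizer_infinity\<close>).

  Hence every matrix is a unit scalar times an element of \<open>\<Gamma>\<close>, and the projection modulo scalars
  carries \<open>\<Gamma>\<close> onto the whole quotient.
\<close>

section \<open>Norms, units and approximation in the Eisenstein integers\<close>

lemma Eisenstein_ints_0: "0 \<in> Eisenstein_ints" and Eisenstein_ints_1: "1 \<in> Eisenstein_ints"
  using Eisenstein_ints_of_int[of 0] Eisenstein_ints_of_int[of 1] by simp_all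

lemma Eisenstein_ints_diff:
  "x \<in> Eisenstein_ints \<Longrightarrow> y \<in> Eisenstein_ints \<Longrightarrow> x - y \<in> Eisenstein_ints"
  using Eisenstein_ints_add[OF _ Eisenstein_ints_uminus] by fastforce

lemma cmod_Eisenstein_square:
  "(cmod (of_int a + of_int b * \<omega>\<^sub>3))\<^sup>2 = of_int (a\<^sup>2 - a * b + b\<^sup>2)"
proof -
  have "(cmod (of_int a + of_int b * \<omega>\<^sub>3))\<^sup>2 = (a - b / 2)\<^sup>2 + (b * sqrt 3 / 2)\<^sup>2"
    unfolding cmod_power2 by (simp add: \<omega>\<^sub>3_def)
  also have "\<dots> = of_int (a\<^sup>2 - a * b + b\<^sup>2)"
    by (simp add: power2_eq_square algebra_simps)
  finally show ?thesis .
qed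

lemma Eisenstein_norm_nat:
  assumes "x \<in> Eisenstein_ints"
  shows "\<exists>n::nat. (cmod x)\<^sup>2 = real n"
proof -
  obtain a b where x: "x = of_int a + of_int b * \<omega>\<^sub>3"
    using assms unfolding Eisenstein_ints_def by blast
  have "real_of_int (a\<^sup>2 - a * b + b\<^sup>2) \<ge> 0"
    unfolding cmod_Eisenstein_square[symmetric] by simp
  then have "a\<^sup>2 - a * b + b\<^sup>2 \<ge> 0" by linarith
  then have "(cmod x)\<^sup>2 = real (nat (a\<^sup>2 - a * b + b\<^sup>2))"
    unfolding x cmod_Eisenstein_square using of_nat_nat by metis
  then show ?thesis ..
qed

text \<open>The norm form \<open>a\<^sup>2 - a b + b\<^sup>2\<close> is definite: four times it is \<open>(2 a - b)\<^sup>2 + 3 b\<^sup>2\<close> and, by symmetry,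
  \<open>(2 b - a)\<^sup>2 + 3 a\<^sup>2\<close>. Norm 1 thus leaves only coefficients in \<open>{-1, 0, 1}\<close>.\<close>

lemma Eisenstein_unitI:
  assumes "x \<in> Eisenstein_ints" "cnj x * x = 1"
  shows "x \<in> Eisenstein_units"
proof -
  obtain a b where x: "x = of_int a + of_int b * \<omega>\<^sub>3"
    using assms unfolding Eisenstein_ints_def by blast
  have "(cmod x)\<^sup>2 = 1"
    using assms(2) by (metis complex_norm_square mult.commute of_real_eq_1_iff)
  then have n: "a\<^sup>2 - a * b + b\<^sup>2 = 1"
    unfolding x cmod_Eisenstein_square by linarith
  have "(2 * a - b)\<^sup>2 + 3 * b\<^sup>2 = 4" "(2 * b - a)\<^sup>2 + 3 * a\<^sup>2 = 4"
    using n by (simp_all add: power2_eq_square algebra_simps)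
  then have "3 * b\<^sup>2 \<le> 4" "3 * a\<^sup>2 \<le> 4"
    using zero_le_power2[of "2 * a - b"] zero_le_power2[of "2 * b - a"] by linarith+
  then have "\<bar>b\<bar>\<^sup>2 < 2\<^sup>2" "\<bar>a\<bar>\<^sup>2 < 2\<^sup>2" by simp_all
  then have "\<bar>b\<bar> < 2" "\<bar>a\<bar> < 2" using power2_less_imp_less by fastforce+
  then have "a \<in> {-1, 0, 1}" "b \<in> {-1, 0, 1}" by auto
  with n have "(a, b) \<in> {(1, 0), (-1, 0), (0, 1), (0, -1), (-1, -1), (1, 1)}" by auto
  then show ?thesis
    unfolding x Eisenstein_units_def omega3_sq by auto
qed

lemma Eisenstein_unit_of_mult:
  assumes "x \<in> Eisenstein_ints" "y \<in> Eisenstein_ints" "x * y = 1"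
  shows "x \<in> Eisenstein_units"
proof -
  obtain m n :: nat where mn: "(cmod x)\<^sup>2 = real m" "(cmod y)\<^sup>2 = real n"
    using assms Eisenstein_norm_nat by meson
  have "(cmod x)\<^sup>2 * (cmod y)\<^sup>2 = (cmod (x * y))\<^sup>2" by (simp add: norm_mult power_mult_distrib)
  then have "real (m * n) = real 1" unfolding mn assms(3) by simp
  then have "m = 1" unfolding of_nat_eq_iff by simp
  then have "cnj x * x = 1" using mn by (metis complex_norm_square mult.commute of_nat_1 of_real_1)
  then show ?thesis using assms by (intro Eisenstein_unitI)
qed

text \<open>Two natural numbers with sum 1 are 0 and 1. This is why unitary matrices over the Eisenstein
  integers are monomial.\<close>

lemma Eisenstein_unit_vector:
  assumes "x \<in> Eisenstein_ints" "y \<in> Eisenstein_ints" "cnj x * x + cnj y * y = 1"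
  shows "x \<in> Eisenstein_units \<and> y = 0 \<or> x = 0 \<and> y \<in> Eisenstein_units"
proof -
  obtain m n :: nat where mn: "(cmod x)\<^sup>2 = real m" "(cmod y)\<^sup>2 = real n"
    using assms Eisenstein_norm_nat by meson
  have cc: "cnj w * w = of_real ((cmod w)\<^sup>2)" for w
    by (metis complex_norm_square mult.commute)
  have "of_real (real (m + n)) = (1 :: complex)"
    using assms(3) unfolding cc mn by simp
  then have "m + n = 1" by (metis of_nat_eq_1_iff of_real_of_nat_eq)
  then have "m = 1 \<and> n = 0 \<or> m = 0 \<and> n = 1" by auto
  then show ?thesis
    using mn assms cc[of x] cc[of y] by (auto intro: Eisenstein_unitI)
qed

text \<open>The Eisenstein integers lie on horizontal rows at distance \<open>\<surd>3/2\<close>, with spacing 1 in each row.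
  Going to the nearest row and then to the nearest point of that row gives
  \<open>(\<surd>3/4)\<^sup>2 + (1/2)\<^sup>2 = 7/16\<close>. The sharp bound is \<open>1/3\<close>, but \<open>7/16\<close> is small enough for the reduction
  step, whereas rounding both coordinates with respect to the basis \<open>1, \<omega>\<^sub>3\<close> only gives \<open>3/4\<close>, which
  is too large.\<close>

lemma Eisenstein_approximation:
  "\<exists>x\<in>Eisenstein_ints. (cmod (w + x))\<^sup>2 \<le> 7 / 16"
proof -
  define l where "l = round (2 * Im w / sqrt 3)"
  define k where "k = round (Re w + l / 2)"
  let ?x = "of_int (- k) + of_int (- l) * \<omega>\<^sub>3"
  have "\<bar>Re (w + ?x)\<bar> \<le> 1 / 2"
    using of_int_round_abs_le[of "Re w + l / 2"] unfolding k_def[symmetric]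
    by (simp add: \<omega>\<^sub>3_def abs_minus_commute algebra_simps)
  then have re: "(Re (w + ?x))\<^sup>2 \<le> (1 / 2)\<^sup>2"
    by (metis abs_ge_zero power2_abs power_mono)
  have "Im (w + ?x) = - (sqrt 3 / 2 * (l - 2 * Im w / sqrt 3))"
    by (simp add: \<omega>\<^sub>3_def field_simps)
  also have "\<bar>\<dots>\<bar> \<le> sqrt 3 / 2 * (1 / 2)"
    unfolding abs_minus_cancel abs_mult
    using of_int_round_abs_le[of "2 * Im w / sqrt 3"] unfolding l_def
    by (intro mult_mono) auto
  finally have "\<bar>Im (w + ?x)\<bar> \<le> sqrt 3 / 4" by simp
  then have "(Im (w + ?x))\<^sup>2 \<le> (sqrt 3 / 4)\<^sup>2"
    by (metis abs_ge_zero power2_abs power_mono)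
  with re have "(cmod (w + ?x))\<^sup>2 \<le> 7 / 16"
    unfolding cmod_power2 by (simp add: power_divide)
  moreover have "?x \<in> Eisenstein_ints" unfolding Eisenstein_ints_def by blast
  ultimately show ?thesis by blast
qed

section \<open>Heisenberg translations and rotations\<close>

text \<open>The Heisenberg translation by \<open>\<tau> = (x, y)\<close>, parametrized by its corner entry
  \<open>z = (- |\<tau>|\<^sup>2 + i t)/2\<close> instead of \<open>t\<close>: integrality is then a condition on \<open>x\<close>, \<open>y\<close>, \<open>z\<close> alone, and
  the relation between \<open>z\<close> and \<open>\<tau>\<close> is the condition to preserve the Hermitian form.\<close>

definition heis :: "complex \<Rightarrow> complex \<Rightarrow> complex \<Rightarrow> complex^4^4" where
  "heis x y z = vector [vector [1, - cnj x, - cnj y, z],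
                        vector [0, 1, 0, x],
                        vector [0, 0, 1, y],
                        vector [0, 0, 0, 1]]"

definition rot :: "complex \<Rightarrow> complex \<Rightarrow> complex \<Rightarrow> complex \<Rightarrow> complex^4^4" where
  "rot a b c d = heis_rotation (vector [vector [a, b], vector [c, d]])"

lemmas matrix4_simps = matrix_matrix_mult_def vec_eq_iff forall_4 sum_4 vector_def

lemma heis_mult:
  "heis x y z ** heis x' y' z' = heis (x + x') (y + y') (z + z' - cnj x * x' - cnj y * y')"
  by (simp add: heis_def matrix4_simps algebra_simps)

lemma rot_mult:
  "rot a b c d ** rot a' b' c' d'
     = rot (a * a' + b * c') (a * b' + b * d') (c * a' + d * c') (c * b' + d * d')"
  by (simp add: rot_def heis_rotation_def matrix4_simps algebra_simps)

lemma heis_conj_diag: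
  assumes "cnj u * u = 1"
  shows "rot u 0 0 1 ** heis x 0 z ** rot (cnj u) 0 0 1 = heis (u * x) 0 z"
  using assms
  by (simp add: rot_def heis_rotation_def heis_def matrix4_simps algebra_simps)

lemma heis_conj_swap:
  "rot 0 1 1 0 ** heis x y z ** rot 0 1 1 0 = heis y x z"
  by (simp add: rot_def heis_rotation_def heis_def matrix4_simps algebra_simps)

lemma heis_0: "heis 0 0 0 = mat 1"
  by (simp add: heis_def matrix4_simps mat_def)

lemma rot_1: "rot 1 0 0 1 = mat 1"
  by (simp add: rot_def heis_rotation_def matrix4_simps mat_def)

text \<open>The entries of \<open>A\<^sup>* J A = J\<close>: the columns of \<open>A\<close> have the same Hermitian products as the
  standard basis.\<close>

lemma U31_entry:
  assumes "A \<in> carrier U31_Eisenstein"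
  shows "cnj (A $ 1 $ i) * A $ 4 $ j + cnj (A $ 2 $ i) * A $ 2 $ j
       + cnj (A $ 3 $ i) * A $ 3 $ j + cnj (A $ 4 $ i) * A $ 1 $ j = J_form $ i $ j"
proof -
  have "(conj_transpose A ** J_form ** A) $ i $ j = J_form $ i $ j"
    using assms by simp
  then show ?thesis
    by (simp add: conj_transpose_def J_form_def matrix_matrix_mult_def sum_4 vector_def algebra_simps)
qed

lemma heis_carrier_iff:
  "heis x y z \<in> carrier U31_Eisenstein \<longleftrightarrow>
     x \<in> Eisenstein_ints \<and> y \<in> Eisenstein_ints \<and> z \<in> Eisenstein_ints \<and>
     z + cnj z + cnj x * x + cnj y * y = 0"
proof -
  have "conj_transpose (heis x y z) ** J_form ** heis x y z = J_form \<longleftrightarrow>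
      z + cnj z + cnj x * x + cnj y * y = 0"
    by (simp add: heis_def conj_transpose_def J_form_def matrix4_simps) (simp add: algebra_simps)
  moreover have "(\<forall>i j. heis x y z $ i $ j \<in> Eisenstein_ints) \<longleftrightarrow>
      x \<in> Eisenstein_ints \<and> y \<in> Eisenstein_ints \<and> z \<in> Eisenstein_ints"
    using Eisenstein_ints_0 Eisenstein_ints_1 Eisenstein_ints_uminus[OF Eisenstein_ints_cnj]
    by (simp add: heis_def forall_4 vector_def) blast
  ultimately show ?thesis by simp blast
qed

section \<open>The subgroup generated by the four matrices\<close>

definition gens :: "(complex^4^4) set" where
  "gens = {N\<^sub>1, M_U\<^sub>1, M_U\<^sub>2, R_mat}"

definition \<Gamma> :: "(complex^4^4) set" where
  "\<Gamma> = generate U31_Eisenstein gens"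

interpretation E: Group.group U31_Eisenstein
  by (rule group_U31_Eisenstein)

lemma gens_subset_\<Gamma>: "gens \<subseteq> \<Gamma>"
  unfolding \<Gamma>_def by (auto intro: generate.incl)

lemma \<Gamma>_mult: "A \<in> \<Gamma> \<Longrightarrow> B \<in> \<Gamma> \<Longrightarrow> A ** B \<in> \<Gamma>"
  unfolding \<Gamma>_def using generate.eng by fastforce

lemma \<Gamma>_1: "mat 1 \<in> \<Gamma>"
  using generate.one[of U31_Eisenstein gens] by (simp add: \<Gamma>_def)

lemma \<Gamma>_carrier: "A \<in> \<Gamma> \<Longrightarrow> A \<in> carrier U31_Eisenstein"
  unfolding \<Gamma>_def gens_def using E.generate_in_carrier[OF generators_in_U31_Eisenstein] by blast

lemma \<Gamma>_inverse:
  assumes "A \<in> \<Gamma>" "A ** B = mat 1"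
  shows "B \<in> \<Gamma>"
proof -
  let ?I = "inv\<^bsub>U31_Eisenstein\<^esub> A"
  have "?I ** A = mat 1"
    using E.l_inv[OF \<Gamma>_carrier[OF assms(1)]] by simp
  then have "?I = B"
    using assms(2) by (metis matrix_mul_assoc matrix_mul_lid matrix_mul_rid)
  moreover have "?I \<in> \<Gamma>"
    using E.generate_m_inv_closed[OF generators_in_U31_Eisenstein] assms(1)
    unfolding \<Gamma>_def gens_def by blast
  ultimately show ?thesis by simp
qed

lemma heis_N1: "heis 1 0 \<omega>\<^sub>3 \<in> \<Gamma>"
  using gens_subset_\<Gamma> by (simp add: gens_def heis_def N\<^sub>1_def)

lemma rot_swap: "rot 0 1 1 0 \<in> \<Gamma>"
  using gens_subset_\<Gamma> by (simp add: gens_def rot_def M_U1_eq_heis_rotation)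

lemma R_\<Gamma>: "R_mat \<in> \<Gamma>"
  using gens_subset_\<Gamma> by (simp add: gens_def)

text \<open>The unit \<open>- \<omega>\<^sub>3\<close> in \<open>M_U\<^sub>2\<close> has order 6, so its powers are all the units.\<close>

lemma rot_unit:
  assumes "u \<in> Eisenstein_units"
  shows "rot u 0 0 1 \<in> \<Gamma>"
proof -
  let ?z = "- \<omega>\<^sub>3"
  have base: "rot ?z 0 0 1 \<in> \<Gamma>"
    using gens_subset_\<Gamma> by (simp add: gens_def rot_def M_U2_eq_heis_rotation)
  have pow: "rot (?z ^ k) 0 0 1 \<in> \<Gamma>" for k
  proof (induction k)
    case (Suc k)
    show ?case using \<Gamma>_mult[OF base Suc] by (simp add: rot_mult)
  qed (simp add: rot_1 \<Gamma>_1)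
  have c: "\<omega>\<^sub>3 ^ 3 = 1"
    by (simp add: power3_eq_cube omega3_mult_self algebra_simps)
  have "?z ^ 0 = 1" "?z ^ 1 = - \<omega>\<^sub>3" "?z ^ 2 = \<omega>\<^sub>3\<^sup>2" "?z ^ 3 = - 1"
    "?z ^ 4 = \<omega>\<^sub>3" "?z ^ 5 = - (\<omega>\<^sub>3\<^sup>2)"
    using c by (simp_all add: eval_nat_numeral mult.assoc)
  then have "\<exists>k. u = ?z ^ k"
    using assms unfolding Eisenstein_units_def by (elim insertE emptyE; metis)
  then show ?thesis using pow by blast
qed

lemma rot_diag:
  assumes "u \<in> Eisenstein_units" "v \<in> Eisenstein_units"
  shows "rot u 0 0 v \<in> \<Gamma>"
  using \<Gamma>_mult[OF \<Gamma>_mult[OF \<Gamma>_mult[OF rot_unit[OF assms(1)] rot_swap]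
    rot_unit[OF assms(2)]] rot_swap]
  by (simp add: rot_mult)

lemma rot_antidiag:
  assumes "u \<in> Eisenstein_units" "v \<in> Eisenstein_units"
  shows "rot 0 u v 0 \<in> \<Gamma>"
  using \<Gamma>_mult[OF rot_diag[OF assms] rot_swap] by (simp add: rot_mult)

lemma heis_unit:
  assumes "u \<in> Eisenstein_units"
  shows "heis u 0 \<omega>\<^sub>3 \<in> \<Gamma>"
  using \<Gamma>_mult[OF \<Gamma>_mult[OF rot_unit[OF assms] heis_N1] rot_unit[OF Eisenstein_units_cnj[OF assms]]]
  unfolding heis_conj_diag[OF Eisenstein_units_norm[OF assms]] by simp

text \<open>Conjugation by rotations turns \<open>N\<^sub>1\<close> into the translations by \<open>1\<close> and by \<open>- 1\<close> with the same
  corner entry \<open>\<omega>\<^sub>3\<close>. They are not inverse to each other: their product is the vertical translation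
  with corner entry \<open>2 \<omega>\<^sub>3 + 1 = i \<surd>3\<close>, and this generates all the purely imaginary Eisenstein
  integers.\<close>

lemma vertical_translation: "heis 0 0 (of_int k * (2 * \<omega>\<^sub>3 + 1)) \<in> \<Gamma>"
proof -
  let ?s = "2 * \<omega>\<^sub>3 + 1"
  have u: "1 \<in> Eisenstein_units" "- 1 \<in> Eisenstein_units"
    by (auto simp: Eisenstein_units_def)
  have p: "heis 0 0 ?s \<in> \<Gamma>"
    using \<Gamma>_mult[OF heis_unit[OF u(1)] heis_unit[OF u(2)]] by (simp add: heis_mult)
  have q: "heis 0 0 (- ?s) \<in> \<Gamma>"
    by (rule \<Gamma>_inverse[OF p]) (simp add: heis_mult heis_0)
  show ?thesis
  proof (induction k rule: int_induct[where k = 0])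
    case base
    show ?case by (simp add: heis_0 \<Gamma>_1)
  next
    case (step1 i)
    show ?case using \<Gamma>_mult[OF step1(2) p] by (simp add: heis_mult algebra_simps)
  next
    case (step2 i)
    show ?case using \<Gamma>_mult[OF step2(2) q] by (simp add: heis_mult algebra_simps)
  qed
qed


lemma horizontal_multiple_of_unit:
  assumes "u \<in> Eisenstein_units"
  shows "\<exists>z. heis (of_int k * u) 0 z \<in> \<Gamma>"
proof (induction k rule: int_induct[where k = 0])
  case base
  show ?case by (intro exI[of _ 0]) (simp add: heis_0 \<Gamma>_1)
next
  case (step1 i)
  then obtain z where z: "heis (of_int i * u) 0 z \<in> \<Gamma>" by blast
  show ?case
    using \<Gamma>_mult[OF z heis_unit[OF assms]] unfolding heis_mult
    by (intro exI) (simp add: algebra_simps)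
next
  case (step2 i)
  then obtain z where z: "heis (of_int i * u) 0 z \<in> \<Gamma>" by blast
  show ?case
    using \<Gamma>_mult[OF z heis_unit[OF Eisenstein_units_uminus[OF assms]]] unfolding heis_mult
    by (intro exI) (simp add: algebra_simps)
qed

lemma horizontal_translation:
  assumes "x \<in> Eisenstein_ints"
  shows "\<exists>z. heis x 0 z \<in> \<Gamma>"
proof -
  obtain a b where x: "x = of_int a * 1 + of_int b * \<omega>\<^sub>3"
    using assms unfolding Eisenstein_ints_def by auto
  have u: "1 \<in> Eisenstein_units" "\<omega>\<^sub>3 \<in> Eisenstein_units"
    by (auto simp: Eisenstein_units_def)
  obtain z z' where "heis (of_int a * 1) 0 z \<in> \<Gamma>" "heis (of_int b * \<omega>\<^sub>3) 0 z' \<in> \<Gamma>"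
    using horizontal_multiple_of_unit[OF u(1)] horizontal_multiple_of_unit[OF u(2)] by meson
  from \<Gamma>_mult[OF this] show ?thesis
    unfolding heis_mult x[symmetric] by auto
qed

text \<open>An integral translation is determined by \<open>\<tau>\<close> up to a vertical translation, because two corner
  entries for the same \<open>\<tau>\<close> have the same real part. It is therefore enough to have one element of
  \<open>\<Gamma>\<close> over each \<open>\<tau>\<close>.\<close>

lemma integral_heis_in_\<Gamma>:
  assumes "heis x y z \<in> carrier U31_Eisenstein"
  shows "heis x y z \<in> \<Gamma>"
proof -
  have xyz: "x \<in> Eisenstein_ints" "y \<in> Eisenstein_ints" "z \<in> Eisenstein_ints"
    "z + cnj z + cnj x * x + cnj y * y = 0"
    using assms unfolding heis_carrier_iff by auto
  obtain z1 z2 where z1: "heis x 0 z1 \<in> \<Gamma>" and z2: "heis y 0 z2 \<in> \<Gamma>"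
    using horizontal_translation xyz by meson
  have "heis 0 y z2 \<in> \<Gamma>"
    using \<Gamma>_mult[OF \<Gamma>_mult[OF rot_swap z2] rot_swap] unfolding heis_conj_swap .
  from \<Gamma>_mult[OF z1 this] have z0: "heis x y (z1 + z2) \<in> \<Gamma>"
    by (simp add: heis_mult)
  let ?w = "z - (z1 + z2)"
  have c: "z1 + z2 \<in> Eisenstein_ints" "(z1 + z2) + cnj (z1 + z2) + cnj x * x + cnj y * y = 0"
    using \<Gamma>_carrier[OF z0] unfolding heis_carrier_iff by auto
  have "?w + cnj ?w =
    (z + cnj z + cnj x * x + cnj y * y) - ((z1 + z2) + cnj (z1 + z2) + cnj x * x + cnj y * y)"
    by simp
  then have "?w + cnj ?w = 0" unfolding c xyz by simp
  then have re: "Re ?w = 0" by (simp add: complex_eq_iff)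
  obtain a b where w: "?w = of_int a + of_int b * \<omega>\<^sub>3"
    using Eisenstein_ints_diff[OF xyz(3) c(1)] unfolding Eisenstein_ints_def by auto
  have "real_of_int b = real_of_int (2 * a)"
    using re unfolding w by (simp add: \<omega>\<^sub>3_def)
  then have "b = 2 * a" unfolding of_int_eq_iff .
  then have "?w = of_int a * (2 * \<omega>\<^sub>3 + 1)" unfolding w by (simp add: algebra_simps)
  then have "z1 + z2 + of_int a * (2 * \<omega>\<^sub>3 + 1) = z"
    by (metis add.commute diff_add_cancel)
  with \<Gamma>_mult[OF z0 vertical_translation[of a]] show ?thesis
    by (simp only: heis_mult) simp
qed

lemma unitary_rot_in_\<Gamma>:
  assumes "a \<in> Eisenstein_ints" "b \<in> Eisenstein_ints" "c \<in> Eisenstein_ints" "d \<in> Eisenstein_ints"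
    and "cnj a * a + cnj c * c = 1" "cnj b * b + cnj d * d = 1" "cnj a * b + cnj c * d = 0"
  shows "rot a b c d \<in> \<Gamma>"
  using Eisenstein_unit_vector[OF assms(1,3,5)] Eisenstein_unit_vector[OF assms(2,4,6)] assms(5-7)
  by (auto intro: rot_diag rot_antidiag)

section \<open>The stabilizer of the point at infinity\<close>

lemma fixes_infinity_\<Gamma>:
  assumes A: "A \<in> carrier U31_Eisenstein"
    and "A $ 1 $ 1 = 1" "A $ 2 $ 1 = 0" "A $ 3 $ 1 = 0" "A $ 4 $ 1 = 0"
  shows "A \<in> \<Gamma>"
proof -
  have O: "A $ i $ j \<in> Eisenstein_ints" for i j using A by simp
  note e = U31_entry[OF A]
  have r4: "A $ 4 $ 2 = 0" "A $ 4 $ 3 = 0" "A $ 4 $ 4 = 1"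
    using e[of 1 2] e[of 1 3] e[of 1 4] assms(2-) by (simp_all add: J_form_def vector_def)
  have "heis (A $ 2 $ 4) (A $ 3 $ 4) (A $ 1 $ 4) \<in> \<Gamma>"
    using e[of 4 4] r4 O
    by (intro integral_heis_in_\<Gamma>, simp only: heis_carrier_iff) (simp add: J_form_def vector_def algebra_simps)
  moreover have "rot (A $ 2 $ 2) (A $ 2 $ 3) (A $ 3 $ 2) (A $ 3 $ 3) \<in> \<Gamma>"
    using e[of 2 2] e[of 3 3] e[of 2 3] r4 O by (intro unitary_rot_in_\<Gamma>) (simp_all add: J_form_def vector_def)
  moreover have "A = heis (A $ 2 $ 4) (A $ 3 $ 4) (A $ 1 $ 4) **
      rot (A $ 2 $ 2) (A $ 2 $ 3) (A $ 3 $ 2) (A $ 3 $ 3)"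
    using e[of 4 2] e[of 4 3] r4 assms(2-)
    by (simp add: heis_def rot_def heis_rotation_def J_form_def matrix4_simps algebra_simps
        eq_neg_iff_add_eq_0)
  ultimately show ?thesis using \<Gamma>_mult by metis
qed

lemma scalar_mult_entry: "(mat c ** A) $ i $ j = c * A $ i $ j" for A :: "complex^4^4"
  using exhaust_4[of i] by (auto simp: matrix_matrix_mult_def mat_def sum_4)

text \<open>The first column \<open>(a, b, b', 0)\<close> is isotropic, so \<open>|b|\<^sup>2 + |b'|\<^sup>2 = 0\<close>. Its product with the last
  column shows that \<open>a\<close> is a unit, and dividing by \<open>a\<close> reduces to the case \<open>a = 1\<close>.\<close>

lemma stabilizer_infinity:
  assumes G: "G \<in> carrier U31_Eisenstein" and z: "G $ 4 $ 1 = 0"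
  shows "\<exists>c\<in>Eisenstein_units. \<exists>A\<in>\<Gamma>. G = mat c ** A"
proof -
  have O: "G $ i $ j \<in> Eisenstein_ints" for i j using G by simp
  note e = U31_entry[OF G]
  let ?c = "G $ 1 $ 1"
  have "of_real ((cmod (G $ 2 $ 1))\<^sup>2 + (cmod (G $ 3 $ 1))\<^sup>2) = (0 :: complex)"
    using e[of 1 1] z
    by (simp add: J_form_def vector_def complex_norm_square mult.commute del: of_real_power)
  then have "(cmod (G $ 2 $ 1))\<^sup>2 + (cmod (G $ 3 $ 1))\<^sup>2 = 0" by (metis of_real_eq_0_iff)
  then have b: "G $ 2 $ 1 = 0" "G $ 3 $ 1 = 0" by (simp_all add: add_nonneg_eq_0_iff)
  have "cnj ?c * G $ 4 $ 4 = 1"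
    using e[of 1 4] z b by (simp add: J_form_def vector_def)
  then have "cnj ?c \<in> Eisenstein_units"
    using Eisenstein_unit_of_mult Eisenstein_ints_cnj O by blast
  then have u: "?c \<in> Eisenstein_units" using Eisenstein_units_cnj by fastforce
  let ?A = "mat (cnj ?c) ** G"
  have "mat (cnj ?c) \<in> carrier U31_Eisenstein"
    using normal_imp_subgroup[OF normal_unit_scalars, THEN subgroup.subset] Eisenstein_units_cnj[OF u]
    unfolding unit_scalars_def by blast
  then have "?A \<in> carrier U31_Eisenstein" using E.m_closed[OF _ G] by (simp del: U31_Eisenstein_sel(1))
  then have "?A \<in> \<Gamma>"
    using z b Eisenstein_units_norm[OF u]
    by (intro fixes_infinity_\<Gamma>) (simp_all only: scalar_mult_entry, simp_all)
  moreover have "G = mat ?c ** ?A"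
    using Eisenstein_units_norm[OF u]
    by (simp add: matrix_mul_assoc mat_mult_mat mult.commute)
  ultimately show ?thesis using u by blast
qed

section \<open>The Euclidean algorithm\<close>

text \<open>Geometrically, \<open>G\<close> maps a fixed horoball at infinity to a horoball based at the image of infinity,
  and this is the larger the smaller the lower left entry of \<open>G\<close> is. The element \<open>T\<close> of \<open>\<Gamma>\<close> enlarges
  it.\<close>

lemma horoball_reduction:
  assumes G: "G \<in> carrier U31_Eisenstein" and c: "G $ 4 $ 1 \<noteq> 0"
  shows "\<exists>T\<in>\<Gamma>. cmod ((T ** G) $ 4 $ 1) < cmod (G $ 4 $ 1)"
proof -
  define c where "c = G $ 4 $ 1"
  have c0: "c \<noteq> 0" using assms c_def by simp
  define \<alpha> \<beta> \<gamma> where "\<alpha> = G $ 1 $ 1 / c" and "\<beta> = G $ 2 $ 1 / c" and "\<gamma> = G $ 3 $ 1 / c"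
  have col: "G $ 1 $ 1 = \<alpha> * c" "G $ 2 $ 1 = \<beta> * c" "G $ 3 $ 1 = \<gamma> * c" "G $ 4 $ 1 = c"
    using c0 by (simp_all add: \<alpha>_def \<beta>_def \<gamma>_def c_def)
  have "(cnj c * c) * (\<alpha> + cnj \<alpha> + cnj \<beta> * \<beta> + cnj \<gamma> * \<gamma>) = 0"
    using U31_entry[OF G, of 1 1] unfolding col by (simp add: J_form_def vector_def algebra_simps)
  then have null: "\<alpha> + cnj \<alpha> + cnj \<beta> * \<beta> + cnj \<gamma> * \<gamma> = 0" using c0 by simp
  obtain x y where xy: "x \<in> Eisenstein_ints" "y \<in> Eisenstein_ints"
    "(cmod (\<beta> + x))\<^sup>2 \<le> 7 / 16" "(cmod (\<gamma> + y))\<^sup>2 \<le> 7 / 16"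
    using Eisenstein_approximation by meson
  \<comment> \<open>A first integral translation over \<open>(x, y)\<close> has corner entry \<open>(|x|\<^sup>2 + |y|\<^sup>2) \<omega>\<^sub>3\<close>, because
    \<open>\<omega>\<^sub>3 + cnj \<omega>\<^sub>3 = - 1\<close>. It takes \<open>\<alpha>\<close> to \<open>q\<close>; the vertical translation by \<open>k\<close> then makes the
    imaginary part small.\<close>
  define q where "q = \<alpha> - cnj x * \<beta> - cnj y * \<gamma> + (cnj x * x + cnj y * y) * \<omega>\<^sub>3"
  define k where "k = round (- Im q / sqrt 3)"
  define z where "z = (cnj x * x + cnj y * y) * \<omega>\<^sub>3 + of_int k * (2 * \<omega>\<^sub>3 + 1)"
  have "cnj z = (cnj x * x + cnj y * y) * (- 1 - \<omega>\<^sub>3) - of_int k * (2 * \<omega>\<^sub>3 + 1)"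
    by (simp add: z_def cnj_omega3 algebra_simps)
  then have "z + cnj z + cnj x * x + cnj y * y = 0"
    by (simp add: z_def algebra_simps)
  moreover have "z \<in> Eisenstein_ints"
    unfolding z_def mult_2
    by (intro Eisenstein_ints_add Eisenstein_ints_mult Eisenstein_ints_cnj xy Eisenstein_ints_omega3
        Eisenstein_ints_of_int Eisenstein_ints_1)
  ultimately have T: "heis x y z \<in> \<Gamma>"
    using xy by (intro integral_heis_in_\<Gamma>) (simp only: heis_carrier_iff)
  define p where "p = q + of_int k * (2 * \<omega>\<^sub>3 + 1)"
  have new: "((R_mat ** heis x y z) ** G) $ 4 $ 1 = p * c"
    unfolding matrix_mul_assoc[symmetric]
    using col
    by (simp add: R_mat_def heis_def matrix_matrix_mult_def sum_4 vector_def p_def q_def z_def algebra_simps)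
  have s: "2 * \<omega>\<^sub>3 + 1 = \<i> * sqrt 3" by (simp add: \<omega>\<^sub>3_def field_simps)
  \<comment> \<open>The translated point is still isotropic, so its real part is given by its horizontal part.\<close>
  have "p + cnj p = q + cnj q"
    unfolding p_def s by simp
  also have "\<dots> = (\<alpha> + cnj \<alpha> + cnj \<beta> * \<beta> + cnj \<gamma> * \<gamma>)
      - (cnj (\<beta> + x) * (\<beta> + x) + cnj (\<gamma> + y) * (\<gamma> + y))"
    unfolding q_def by (simp add: cnj_omega3 algebra_simps)
  also have "\<dots> = - of_real ((cmod (\<beta> + x))\<^sup>2 + (cmod (\<gamma> + y))\<^sup>2)"
    unfolding null of_real_add complex_norm_square by (simp add: mult.commute)
  finally have "2 * Re p = - ((cmod (\<beta> + x))\<^sup>2 + (cmod (\<gamma> + y))\<^sup>2)"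
    by (simp add: complex_eq_iff)
  then have "\<bar>Re p\<bar> \<le> 7 / 16" using xy(3,4)
    zero_le_power2[of "cmod (\<beta> + x)"] zero_le_power2[of "cmod (\<gamma> + y)"] by linarith
  then have re: "(Re p)\<^sup>2 \<le> (7 / 16)\<^sup>2"
    by (metis abs_ge_zero power2_abs power_mono)
  have "Im p = sqrt 3 * (k - (- Im q / sqrt 3))"
    unfolding p_def s by (simp add: field_simps)
  also have "\<bar>\<dots>\<bar> \<le> sqrt 3 * (1 / 2)"
    unfolding abs_mult k_def
    using of_int_round_abs_le[of "- Im q / sqrt 3"] by (intro mult_mono) auto
  finally have "\<bar>Im p\<bar> \<le> sqrt 3 / 2" by simp
  then have "(Im p)\<^sup>2 \<le> (sqrt 3 / 2)\<^sup>2"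
    by (metis abs_ge_zero power2_abs power_mono)
  with re have "(cmod p)\<^sup>2 < 1\<^sup>2"
    unfolding cmod_power2 by (simp add: power_divide)
  then have "cmod p < 1" by (rule power2_less_imp_less) simp
  then have "cmod (p * c) < cmod c" using c0 by (simp add: norm_mult)
  then show ?thesis
    using \<Gamma>_mult[OF R_\<Gamma> T] new c_def by metis
qed

lemma scalar_times_\<Gamma>:
  assumes "G \<in> carrier U31_Eisenstein"
  shows "\<exists>c\<in>Eisenstein_units. \<exists>A\<in>\<Gamma>. G = mat c ** A"
proof -
  have "\<exists>c\<in>Eisenstein_units. \<exists>A\<in>\<Gamma>. G = mat c ** A"
    if "G \<in> carrier U31_Eisenstein" "(cmod (G $ 4 $ 1))\<^sup>2 = real n" for n G
    using that
  proof (induction n arbitrary: G rule: less_induct)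
    case (less n)
    note G = less.prems(1)
    show ?case
    proof (cases "G $ 4 $ 1 = 0")
      case True
      then show ?thesis by (rule stabilizer_infinity[OF G])
    next
      case False
      obtain T where T: "T \<in> \<Gamma>" "cmod ((T ** G) $ 4 $ 1) < cmod (G $ 4 $ 1)"
        using horoball_reduction[OF G False] by blast
      have TG: "T ** G \<in> carrier U31_Eisenstein"
        using E.m_closed[OF \<Gamma>_carrier[OF T(1)] G] by (simp del: U31_Eisenstein_sel(1))
      then have "(T ** G) $ 4 $ 1 \<in> Eisenstein_ints" by simp
      then obtain m where m: "(cmod ((T ** G) $ 4 $ 1))\<^sup>2 = real m"
        using Eisenstein_norm_nat by blast
      have "real m < real n"
        unfolding m[symmetric] less.prems(2)[symmetric] using T(2) by (intro power_strict_mono) auto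
      then obtain c A where cA: "c \<in> Eisenstein_units" "A \<in> \<Gamma>" "T ** G = mat c ** A"
        using less.IH[OF _ TG m] by auto
      let ?I = "inv\<^bsub>U31_Eisenstein\<^esub> T"
      have I: "?I ** T = mat 1"
        using E.l_inv[OF \<Gamma>_carrier[OF T(1)]] by simp
      then have "?I \<in> \<Gamma>" by (intro \<Gamma>_inverse[OF T(1)]) (simp add: matrix_left_right_inverse)
      moreover have "G = mat c ** (?I ** A)"
        using I cA(3) by (metis mat_commute matrix_mul_assoc matrix_mul_lid)
      ultimately show ?thesis using cA \<Gamma>_mult by blast
    qed
  qed
  moreover have "G $ 4 $ 1 \<in> Eisenstein_ints" using assms by simp
  ultimately show ?thesis using assms Eisenstein_norm_nat by meson
qed

theorem theorem3p2:
  shows "generate PU31_Eisenstein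
           {PU_class N\<^sub>1, PU_class M_U\<^sub>1, PU_class M_U\<^sub>2, PU_class R_mat}
         = carrier PU31_Eisenstein"
proof -
  interpret S: normal unit_scalars U31_Eisenstein by (rule normal_unit_scalars)
  interpret P: group_hom U31_Eisenstein PU31_Eisenstein PU_class
    using S.r_coset_hom_Mod group_PU31_Eisenstein E.group_axioms
    unfolding group_hom_def group_hom_axioms_def PU31_Eisenstein_def PU_class_def by simp
  have "generate PU31_Eisenstein (PU_class ` gens) = PU_class ` \<Gamma>"
    unfolding \<Gamma>_def using P.generate_img generators_in_U31_Eisenstein gens_def by simp
  also have "\<dots> = PU_class ` carrier U31_Eisenstein"
  proof (intro subset_antisym)
    show "PU_class ` \<Gamma> \<subseteq> PU_class ` carrier U31_Eisenstein"
      using \<Gamma>_carrier by blast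
    show "PU_class ` carrier U31_Eisenstein \<subseteq> PU_class ` \<Gamma>"
    proof
      fix X assume "X \<in> PU_class ` carrier U31_Eisenstein"
      then obtain G where G: "G \<in> carrier U31_Eisenstein" "X = PU_class G" by blast
      obtain c A where cA: "c \<in> Eisenstein_units" "A \<in> \<Gamma>" "G = mat c ** A"
        using scalar_times_\<Gamma>[OF G(1)] by blast
      have "G \<in> PU_class A"
        unfolding PU_class_def r_coset_def unit_scalars_def using cA by auto
      then have "PU_class A = PU_class G"
        unfolding PU_class_def
        by (rule E.repr_independence) (use \<Gamma>_carrier[OF cA(2)] S.subgroup_axioms in auto)
      then show "X \<in> PU_class ` \<Gamma>" using cA(2) G(2) by (metis image_eqI)
    qed
  qed
  also have "\<dots> = carrier PU31_Eisenstein"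
    by (auto simp: PU31_Eisenstein_def FactGroup_def RCOSETS_def PU_class_def simp del: U31_Eisenstein_sel(1))
  finally show ?thesis by (simp add: gens_def)
qed

end
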